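(* Let $G$ be a Lie group with Lie algebra $\mathfrak g$. Given a reduced Lagrangian $\ell=\ell(\eta_0,\eta_1,\eta_2)$ on $(\mathfrak g\ltimes\mathfrak g)\ltimes_\theta\mathfrak g$, the Euler-Poincaré equations are $$\frac{d}{dt}\frac{\delta\ell}{\delta\eta_0}=-\mathrm{ad}^*_{\eta_0}\Big(\frac{\delta\ell}{\delta\eta_0}\Big)-\mathrm{ad}^*_{\eta_1}\Big(\frac{\delta\ell}{\delta\eta_1}\Big)-\mathrm{ad}^*_{\eta_2}\Big(\frac{\delta\ell}{\delta\eta_2}\Big),$$ $$\frac{d}{dt}\frac{\delta\ell}{\delta\eta_1}=-\mathrm{ad}^*_{\eta_0}\Big(\frac{\delta\ell}{\delta\eta_1}\Big)-2\,\mathrm{ad}^*_{\eta_1}\Big(\frac{\delta\ell}{\delta\eta_2}\Big),$$ $$\frac{d}{dt}\frac{\delta\ell}{\delta\eta_2}=-\mathrm{ad}^*_{\eta_0}\Big(\frac{\delta\ell}{\delta\eta_2}\Big).$$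
   Context: $(\mathfrak g\ltimes\mathfrak g)\ltimes_\theta\mathfrak g$ is the Lie algebra of the (left trivialized) second order tangent group $T^2G$ (second order jets at $0$ of curves in $G$, with pointwise product). It is a 2-cocycle extension of $\mathfrak g\ltimes\mathfrak g$ by $\mathfrak g$, with $\theta:(\mathfrak g\ltimes\mathfrak g)\otimes(\mathfrak g\ltimes\mathfrak g)\to\mathfrak g$, $\theta((\xi_1,\xi_2),(\xi_3,\xi_4))=-2\,\mathrm{ad}_{\xi_4}\xi_2$; explicitly, on triples $(\eta_0,\eta_1,\eta_2)\in\mathfrak g^{\times3}$, $$[(\eta_0,\eta_1,\eta_2),(\eta_0',\eta_1',\eta_2')]=\big([\eta_0,\eta_0'],\ [\eta_0,\eta_1']+[\eta_1,\eta_0'],\ [\eta_0,\eta_2']+[\eta_2,\eta_0']-2\,\mathrm{ad}_{\eta_1'}\eta_1\big).$$ For a Lie algebra $\mathfrak k$ and $\ell=\ell(\xi)$ on $\mathfrak k$ the Euler-Poincaré equations are $\frac{d}{dt}\frac{\delta\ell}{\delta\xi}=-\mathrm{ad}^*_\xi\big(\frac{\delta\ell}{\delta\xi}\big)$, where $\delta\ell/\delta\xi\in\mathfrak k^*$ is the derivative of $\ell$ and $\langle\mathrm{ad}^*_\xi\mu,\zeta\rangle=-\langle\mu,[\xi,\zeta]\rangle$. In the claim, $\delta\ell/\delta\eta_i\in\mathfrak g^*$ are the partial derivatives and $\mathrm{ad}^*$ is the coadjoint action of $\mathfrak g$ on $\mathfrak g^*$. *)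

theory Defs
  imports "HOL-Analysis.Analysis" "HOL-Algebra.Group"
begin

section \<open>Smooth maps, Lie groups and their Lie algebras\<close>

text \<open>\<open>smooth_on S f\<close>: \<open>f\<close> is \<open>C\<^sup>\<infinity>\<close> on the open set \<open>S\<close>. Coinductively: \<open>f\<close> is Frechet
  differentiable on \<open>S\<close>, and each of its directional derivatives is again smooth on \<open>S\<close>.
  In finite dimensions this is the usual notion.\<close>

coinductive smooth_on :: "'a::euclidean_space set \<Rightarrow> ('a \<Rightarrow> 'b::euclidean_space) \<Rightarrow> bool" where
  "\<lbrakk>\<And>x. x \<in> S \<Longrightarrow> (f has_derivative f' x) (at x);
    \<And>v. smooth_on S (\<lambda>x. f' x v)\<rbrakk> \<Longrightarrow> smooth_on S f"

text \<open>A chart is a pair \<open>(U, \<phi>)\<close>; \<open>\<phi>\<close> is only meaningful on \<open>U\<close>, and its inverse is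
  \<^term>\<open>inv_into U \<phi>\<close>.\<close>

locale smooth_manifold =
  fixes X :: "'a topology" and \<A> :: "('a set \<times> ('a \<Rightarrow> 'e::euclidean_space)) set"
  assumes Hausdorff: "Hausdorff_space X"
    and second_countable: "second_countable X"
    and charts_cover: "(\<Union>(U, \<phi>) \<in> \<A>. U) = topspace X"
    and chart_open: "(U, \<phi>) \<in> \<A> \<Longrightarrow> openin X U"
    and chart_image_open: "(U, \<phi>) \<in> \<A> \<Longrightarrow> open (\<phi> ` U)"
    and chart_homeomorphic:
      "(U, \<phi>) \<in> \<A> \<Longrightarrow> homeomorphic_map (subtopology X U) (top_of_set (\<phi> ` U)) \<phi>"
    and charts_compatible: "\<lbrakk>(U, \<phi>) \<in> \<A>; (V, \<psi>) \<in> \<A>\<rbrakk> \<Longrightarrow>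
      smooth_on (\<phi> ` (U \<inter> V)) (\<lambda>x. \<psi> (inv_into U \<phi> x))"

locale lie_group = smooth_manifold X \<A> + group G
  for G :: "'a monoid" and X :: "'a topology"
    and \<A> :: "('a set \<times> ('a \<Rightarrow> 'e::euclidean_space)) set" +
  assumes topspace_eq: "topspace X = carrier G"
    and mult_continuous: "continuous_map (prod_topology X X) X (\<lambda>(g, h). g \<otimes>\<^bsub>G\<^esub> h)"
    and inv_continuous: "continuous_map X X (\<lambda>g. inv\<^bsub>G\<^esub> g)"
    and mult_smooth: "\<lbrakk>(U, \<phi>) \<in> \<A>; (V, \<psi>) \<in> \<A>; (W, \<kappa>) \<in> \<A>\<rbrakk> \<Longrightarrow>
      smooth_on {(x, y). x \<in> \<phi> ` U \<and> y \<in> \<psi> ` V \<and> inv_into U \<phi> x \<otimes>\<^bsub>G\<^esub> inv_into V \<psi> y \<in> W}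
        (\<lambda>(x, y). \<kappa> (inv_into U \<phi> x \<otimes>\<^bsub>G\<^esub> inv_into V \<psi> y))"
    and inv_smooth: "\<lbrakk>(U, \<phi>) \<in> \<A>; (V, \<psi>) \<in> \<A>\<rbrakk> \<Longrightarrow>
      smooth_on {x \<in> \<phi> ` U. inv\<^bsub>G\<^esub> (inv_into U \<phi> x) \<in> V}
        (\<lambda>x. \<psi> (inv\<^bsub>G\<^esub> (inv_into U \<phi> x)))"

text \<open>A chart \<open>(U, \<phi>)\<close> around the identity identifies \<open>T\<^sub>eG\<close> with the model space of the
  manifold. In this chart, \<open>left_invariant_field G U \<phi> \<xi>\<close> is the left invariant vector field
  \<open>g \<mapsto> dL\<^sub>g(\<xi>)\<close> (on \<open>\<phi> ` U\<close>), and the Lie bracket of \<open>\<xi>\<close> and \<open>\<zeta>\<close> is the Jacobi-Lie bracket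
  \<open>[X, Y] = DY(X) - DX(Y)\<close> of the corresponding fields, evaluated at the identity.\<close>

definition left_invariant_field ::
    "'a monoid \<Rightarrow> 'a set \<Rightarrow> ('a \<Rightarrow> 'g::euclidean_space) \<Rightarrow> 'g \<Rightarrow> 'g \<Rightarrow> 'g" where
  "left_invariant_field G U \<phi> \<xi> x =
     frechet_derivative (\<lambda>y. \<phi> (inv_into U \<phi> x \<otimes>\<^bsub>G\<^esub> inv_into U \<phi> y)) (at (\<phi> \<one>\<^bsub>G\<^esub>)) \<xi>"

definition lie_bracket ::
    "'a monoid \<Rightarrow> 'a set \<Rightarrow> ('a \<Rightarrow> 'g::euclidean_space) \<Rightarrow> 'g \<Rightarrow> 'g \<Rightarrow> 'g" where
  "lie_bracket G U \<phi> \<xi> \<zeta> =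
     frechet_derivative (left_invariant_field G U \<phi> \<zeta>) (at (\<phi> \<one>\<^bsub>G\<^esub>))
       (left_invariant_field G U \<phi> \<xi> (\<phi> \<one>\<^bsub>G\<^esub>))
   - frechet_derivative (left_invariant_field G U \<phi> \<xi>) (at (\<phi> \<one>\<^bsub>G\<^esub>))
       (left_invariant_field G U \<phi> \<zeta> (\<phi> \<one>\<^bsub>G\<^esub>))"


section \<open>The Lie algebra $(\mathfrak g\ltimes\mathfrak g)\ltimes_\theta\mathfrak g$\<close>

text \<open>The extension of a Lie algebra with bracket \<open>b\<close> by a module with action \<open>\<rho>\<close>, twisted by
  a 2-cocycle \<open>\<theta>\<close>; for \<open>\<theta> = 0\<close> it is the semidirect product.\<close>

definition cocycle_extension ::
    "('h \<Rightarrow> 'h \<Rightarrow> 'h) \<Rightarrow> ('h \<Rightarrow> 'v \<Rightarrow> 'v) \<Rightarrow> ('h \<Rightarrow> 'h \<Rightarrow> 'v::real_vector) \<Rightarrow>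
     'h \<times> 'v \<Rightarrow> 'h \<times> 'v \<Rightarrow> 'h \<times> 'v" where
  "cocycle_extension b \<rho> \<theta> = (\<lambda>(x, v) (y, w). (b x y, \<rho> x w - \<rho> y v + \<theta> x y))"

definition tangent_bracket ::
    "('g \<Rightarrow> 'g \<Rightarrow> 'g::real_vector) \<Rightarrow> 'g \<times> 'g \<Rightarrow> 'g \<times> 'g \<Rightarrow> 'g \<times> 'g" where
  "tangent_bracket br = cocycle_extension br br (\<lambda>_ _. 0)"

definition theta ::
    "('g \<Rightarrow> 'g \<Rightarrow> 'g::real_vector) \<Rightarrow> 'g \<times> 'g \<Rightarrow> 'g \<times> 'g \<Rightarrow> 'g" where
  "theta br = (\<lambda>(\<xi>\<^sub>1, \<xi>\<^sub>2) (\<xi>\<^sub>3, \<xi>\<^sub>4). - 2 *\<^sub>R br \<xi>\<^sub>4 \<xi>\<^sub>2)"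

text \<open>\<open>\<gg> \<ltimes> \<gg>\<close> acts on \<open>\<gg>\<close> by the adjoint action of the first factor. A triple
  \<open>(\<eta>\<^sub>0, \<eta>\<^sub>1, \<eta>\<^sub>2)\<close> is written \<open>((\<eta>\<^sub>0, \<eta>\<^sub>1), \<eta>\<^sub>2)\<close>.\<close>

definition second_tangent_bracket ::
    "('g \<Rightarrow> 'g \<Rightarrow> 'g::real_vector) \<Rightarrow>
     ('g \<times> 'g) \<times> 'g \<Rightarrow> ('g \<times> 'g) \<times> 'g \<Rightarrow> ('g \<times> 'g) \<times> 'g" where
  "second_tangent_bracket br = cocycle_extension (tangent_bracket br) (\<lambda>(\<xi>, _). br \<xi>) (theta br)"

lemma lie_bracket_antisym: "lie_bracket G U \<phi> \<xi> \<zeta> = - lie_bracket G U \<phi> \<zeta> \<xi>"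
  by (simp add: lie_bracket_def)

lemma second_tangent_bracket_eq:
  assumes antisym: "\<And>\<xi> \<zeta>. br \<xi> \<zeta> = - br \<zeta> \<xi>"
  shows "second_tangent_bracket br ((\<eta>\<^sub>0, \<eta>\<^sub>1), \<eta>\<^sub>2) ((\<eta>\<^sub>0', \<eta>\<^sub>1'), \<eta>\<^sub>2') =
    ((br \<eta>\<^sub>0 \<eta>\<^sub>0', br \<eta>\<^sub>0 \<eta>\<^sub>1' + br \<eta>\<^sub>1 \<eta>\<^sub>0'),
     br \<eta>\<^sub>0 \<eta>\<^sub>2' + br \<eta>\<^sub>2 \<eta>\<^sub>0' - 2 *\<^sub>R br \<eta>\<^sub>1' \<eta>\<^sub>1)"
  using antisym[of \<eta>\<^sub>0' \<eta>\<^sub>1] antisym[of \<eta>\<^sub>0' \<eta>\<^sub>2]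
  by (simp add: second_tangent_bracket_def tangent_bracket_def cocycle_extension_def theta_def)


section \<open>Euler-Poincare equations\<close>

definition coad ::
    "('k \<Rightarrow> 'k \<Rightarrow> 'k) \<Rightarrow> 'k::real_normed_vector \<Rightarrow> ('k \<Rightarrow>\<^sub>L real) \<Rightarrow> ('k \<Rightarrow>\<^sub>L real)" where
  "coad br \<xi> \<mu> = Blinfun (\<lambda>\<zeta>. - blinfun_apply \<mu> (br \<xi> \<zeta>))"

definition var_deriv :: "('k::real_normed_vector \<Rightarrow> real) \<Rightarrow> 'k \<Rightarrow> ('k \<Rightarrow>\<^sub>L real)" where
  "var_deriv l \<xi> = Blinfun (frechet_derivative l (at \<xi>))"

definition euler_poincare_on ::
    "real set \<Rightarrow> ('k \<Rightarrow> 'k \<Rightarrow> 'k) \<Rightarrow> ('k::real_normed_vector \<Rightarrow> real) \<Rightarrow> (real \<Rightarrow> 'k) \<Rightarrow> bool" where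
  "euler_poincare_on T br l \<xi> \<longleftrightarrow>
     (\<forall>t\<in>T. ((\<lambda>s. var_deriv l (\<xi> s)) has_vector_derivative
               - coad br (\<xi> t) (var_deriv l (\<xi> t))) (at t within T))"

definition var_deriv0 :: "(('g \<times> 'g) \<times> 'g \<Rightarrow> real) \<Rightarrow>
    ('g \<times> 'g) \<times> 'g \<Rightarrow> ('g::real_normed_vector \<Rightarrow>\<^sub>L real)" where
  "var_deriv0 l = (\<lambda>((\<eta>\<^sub>0, \<eta>\<^sub>1), \<eta>\<^sub>2). var_deriv (\<lambda>\<xi>. l ((\<xi>, \<eta>\<^sub>1), \<eta>\<^sub>2)) \<eta>\<^sub>0)"

definition var_deriv1 :: "(('g \<times> 'g) \<times> 'g \<Rightarrow> real) \<Rightarrow>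
    ('g \<times> 'g) \<times> 'g \<Rightarrow> ('g::real_normed_vector \<Rightarrow>\<^sub>L real)" where
  "var_deriv1 l = (\<lambda>((\<eta>\<^sub>0, \<eta>\<^sub>1), \<eta>\<^sub>2). var_deriv (\<lambda>\<xi>. l ((\<eta>\<^sub>0, \<xi>), \<eta>\<^sub>2)) \<eta>\<^sub>1)"

definition var_deriv2 :: "(('g \<times> 'g) \<times> 'g \<Rightarrow> real) \<Rightarrow>
    ('g \<times> 'g) \<times> 'g \<Rightarrow> ('g::real_normed_vector \<Rightarrow>\<^sub>L real)" where
  "var_deriv2 l = (\<lambda>((\<eta>\<^sub>0, \<eta>\<^sub>1), \<eta>\<^sub>2). var_deriv (\<lambda>\<xi>. l ((\<eta>\<^sub>0, \<eta>\<^sub>1), \<xi>)) \<eta>\<^sub>2)"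

end

theory Submission
  imports Defs
begin

text \<open>
  Everything rests on one algebraic computation: the dual of a product splits as a product of
  duals, and transposing \<open>\<zeta> \<mapsto> [\<eta>, \<zeta>]\<close> through that splitting sorts the terms of the bracket
  by the slot that \<open>\<zeta>\<close> occupies. A vector in slot 0 is moved by \<open>\<eta>\<^sub>0, \<eta>\<^sub>1, \<eta>\<^sub>2\<close> into slots
  0, 1, 2; a vector in slot 1 is moved by \<open>\<eta>\<^sub>0\<close> into slot 1 and, through the cocycle, by \<open>2 \<eta>\<^sub>1\<close>
  into slot 2; a vector in slot 2 only feels \<open>\<eta>\<^sub>0\<close>. These are the three right-hand sides
  (\<open>coad_second_tangent_bracket_slot0\<close> and its companions). On the other side of the
  equations, restricting \<open>\<delta>l/\<delta>\<eta>\<close> to a slot gives a partial derivative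
  (\<open>var_deriv_slice_fst\<close>, \<open>var_deriv_slice_snd\<close>), and a curve in the dual of a product has a
  given derivative iff its two restrictions do (\<open>has_vector_derivative_blinfun_prod\<close>).

  The geometry enters only through bilinearity of the bracket, without which the coadjoint
  action, a transpose, would be meaningless. In a chart, left invariant fields are partial
  derivatives of the group multiplication at points \<open>(x, e)\<close>. Smoothness of multiplication
  makes them differentiable at the identity and linear in their generating vector, so their
  Jacobi-Lie bracket there is bilinear (\<open>bilinear_lie_bracket\<close>).
\<close>

section \<open>Bilinearity of the Lie bracket\<close>

lemma smooth_on_obtains_derivative:
  assumes "smooth_on S f"
  obtains f' where "\<And>x. x \<in> S \<Longrightarrow> (f has_derivative f' x) (at x)"
    and "\<And>v. smooth_on S (\<lambda>x. f' x v)"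
  using assms by (cases rule: smooth_on.cases) (rule that)

text \<open>For every \<open>x\<close> in the chart the pair \<open>(x, e)\<close> lies in the domain on which multiplication is
  smooth, since \<open>x e = x\<close> stays in the chart. Hence the differential of the local multiplication
  represents the left invariant fields on the whole chart, not just at the identity.\<close>

lemma (in lie_group) left_invariant_field_representation:
  assumes chart: "(U, \<phi>) \<in> \<A>" and one: "\<one>\<^bsub>G\<^esub> \<in> U"
  obtains m' where
    "\<And>x. x \<in> \<phi> ` U \<Longrightarrow> linear (m' x)"
    "\<And>x \<xi>. x \<in> \<phi> ` U \<Longrightarrow> left_invariant_field G U \<phi> \<xi> x = m' x \<xi>"
    "\<And>\<xi>. (\<lambda>x. m' x \<xi>) differentiable (at (\<phi> \<one>\<^bsub>G\<^esub>))"
proof -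
  define e where "e = \<phi> \<one>\<^bsub>G\<^esub>"
  define m where "m = (\<lambda>(x, y). \<phi> (inv_into U \<phi> x \<otimes>\<^bsub>G\<^esub> inv_into U \<phi> y))"
  define S where "S = {(x, y). x \<in> \<phi> ` U \<and> y \<in> \<phi> ` U \<and> inv_into U \<phi> x \<otimes>\<^bsub>G\<^esub> inv_into U \<phi> y \<in> U}"
  have U_top: "U \<subseteq> topspace X"
    using chart_open[OF chart] by (rule openin_subset)
  have "inj_on \<phi> U"
    using homeomorphic_imp_injective_map[OF chart_homeomorphic[OF chart]] U_top
    by (simp add: inf.absorb2)
  then have inv_e: "inv_into U \<phi> e = \<one>\<^bsub>G\<^esub>"
    using one by (simp add: e_def)
  have e_in: "e \<in> \<phi> ` U"
    using one by (simp add: e_def)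
  have slice_in: "(x, e) \<in> S" if "x \<in> \<phi> ` U" for x
  proof -
    have "inv_into U \<phi> x \<in> U" using that by (rule inv_into_into)
    then show ?thesis
      using that e_in U_top by (auto simp: S_def inv_e topspace_eq)
  qed
  have "smooth_on S m"
    using mult_smooth[OF chart chart chart] by (simp add: S_def m_def)
  then obtain D where D: "\<And>p. p \<in> S \<Longrightarrow> (m has_derivative D p) (at p)"
    and D_smooth: "\<And>v. smooth_on S (\<lambda>p. D p v)"
    by (rule smooth_on_obtains_derivative) blast
  show thesis
  proof (rule that[of "\<lambda>x \<xi>. D (x, e) (0, \<xi>)"])
    fix x assume x: "x \<in> \<phi> ` U"
    have "((\<lambda>y. (x, y)) has_derivative (\<lambda>\<xi>. (0, \<xi>))) (at e)"
      by (auto intro!: derivative_eq_intros)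
    from diff_chain_at[OF this D[OF slice_in[OF x]]]
    have der: "((\<lambda>y. m (x, y)) has_derivative (\<lambda>\<xi>. D (x, e) (0, \<xi>))) (at e)"
      by (simp add: o_def)
    then show "linear (\<lambda>\<xi>. D (x, e) (0, \<xi>))"
      by (rule has_derivative_linear)
    show "left_invariant_field G U \<phi> \<xi> x = D (x, e) (0, \<xi>)" for \<xi>
      using fun_cong[OF frechet_derivative_at[OF der], of \<xi>]
      by (simp add: left_invariant_field_def m_def e_def)
  next
    fix \<xi>
    obtain D2 where "((\<lambda>p. D p (0, \<xi>)) has_derivative D2) (at (e, e))"
      using smooth_on_obtains_derivative[OF D_smooth[of "(0, \<xi>)"]] slice_in[OF e_in] by metis
    moreover have "((\<lambda>x. (x, e)) has_derivative (\<lambda>v. (v, 0))) (at e)"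
      by (auto intro!: derivative_eq_intros)
    ultimately have "((\<lambda>x. D (x, e) (0, \<xi>)) has_derivative (\<lambda>v. D2 (v, 0))) (at e)"
      using diff_chain_at[of "\<lambda>x. (x, e)"] by (force simp: o_def)
    then show "(\<lambda>x. D (x, e) (0, \<xi>)) differentiable (at (\<phi> \<one>\<^bsub>G\<^esub>))"
      unfolding e_def differentiable_def by blast
  qed
qed

text \<open>Linearity in the generating vector holds on an open neighbourhood of the identity, so it may
  be differentiated there.\<close>

lemma (in lie_group) bilinear_lie_bracket:
  assumes chart: "(U, \<phi>) \<in> \<A>" and one: "\<one>\<^bsub>G\<^esub> \<in> U"
  shows "bilinear (lie_bracket G U \<phi>)"
proof -
  define e where "e = \<phi> \<one>\<^bsub>G\<^esub>"
  define L where "L = left_invariant_field G U \<phi>"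
  define DL where "DL \<xi> = frechet_derivative (L \<xi>) (at e)" for \<xi>
  obtain m' where lin: "\<And>x. x \<in> \<phi> ` U \<Longrightarrow> linear (m' x)"
    and L_eq: "\<And>x \<xi>. x \<in> \<phi> ` U \<Longrightarrow> L \<xi> x = m' x \<xi>"
    and diff: "\<And>\<xi>. (\<lambda>x. m' x \<xi>) differentiable (at e)"
    using left_invariant_field_representation[OF chart one] unfolding L_def e_def by metis
  have op: "open (\<phi> ` U)" and e_in: "e \<in> \<phi> ` U"
    using chart_image_open[OF chart] one by (auto simp: e_def)
  have L_der: "(L \<xi> has_derivative DL \<xi>) (at e)" for \<xi>
  proof -
    obtain D where D: "((\<lambda>x. m' x \<xi>) has_derivative D) (at e)"
      using diff unfolding differentiable_def by blast
    have "(L \<xi> has_derivative D) (at e)"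
      using has_derivative_transform_within_open[OF D op e_in] L_eq by simp
    then show ?thesis
      unfolding DL_def using frechet_derivative_at by metis
  qed
  have DL_add: "DL (\<xi> + \<zeta>) v = DL \<xi> v + DL \<zeta> v" for \<xi> \<zeta> v
  proof -
    have "((\<lambda>x. L \<xi> x + L \<zeta> x) has_derivative (\<lambda>v. DL \<xi> v + DL \<zeta> v)) (at e)"
      by (intro has_derivative_add L_der)
    then have "(L (\<xi> + \<zeta>) has_derivative (\<lambda>v. DL \<xi> v + DL \<zeta> v)) (at e)"
      by (rule has_derivative_transform_within_open[OF _ op e_in])
        (simp add: L_eq linear_add[OF lin])
    then show ?thesis
      using has_derivative_unique[OF L_der] by metis
  qed
  have DL_scale: "DL (c *\<^sub>R \<xi>) v = c *\<^sub>R DL \<xi> v" for c \<xi> v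
  proof -
    have "((\<lambda>x. c *\<^sub>R L \<xi> x) has_derivative (\<lambda>v. c *\<^sub>R DL \<xi> v)) (at e)"
      by (intro has_derivative_scaleR_right L_der)
    then have "(L (c *\<^sub>R \<xi>) has_derivative (\<lambda>v. c *\<^sub>R DL \<xi> v)) (at e)"
      by (rule has_derivative_transform_within_open[OF _ op e_in])
        (simp add: L_eq linear_scale[OF lin])
    then show ?thesis
      using has_derivative_unique[OF L_der] by metis
  qed
  have DL_lin: "linear (DL \<xi>)" for \<xi>
    using L_der by (rule has_derivative_linear)
  note m'e = linear_add[OF lin[OF e_in]] linear_scale[OF lin[OF e_in]]
  have bracket: "lie_bracket G U \<phi> = (\<lambda>\<xi> \<zeta>. DL \<zeta> (m' e \<xi>) - DL \<xi> (m' e \<zeta>))"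
    unfolding lie_bracket_def L_def[symmetric] e_def[symmetric] DL_def[symmetric]
    by (simp add: L_eq[OF e_in])
  show ?thesis
    unfolding bilinear_def bracket
    by (intro conjI allI linearI)
      (simp_all add: DL_add DL_scale m'e linear_add[OF DL_lin] linear_scale[OF DL_lin]
        scaleR_diff_right)
qed

section \<open>The dual of a product\<close>

definition inl_blinfun :: "'a::real_normed_vector \<Rightarrow>\<^sub>L ('a \<times> 'b::real_normed_vector)" where
  "inl_blinfun = Blinfun (\<lambda>x. (x, 0))"

definition inr_blinfun :: "'b::real_normed_vector \<Rightarrow>\<^sub>L ('a::real_normed_vector \<times> 'b)" where
  "inr_blinfun = Blinfun (\<lambda>y. (0, y))"

lemma inl_blinfun_apply [simp]: "blinfun_apply inl_blinfun x = (x, 0)"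
  unfolding inl_blinfun_def
  by (subst bounded_linear_Blinfun_apply)
    (auto intro: bounded_linear_Pair bounded_linear_ident bounded_linear_zero)

lemma inr_blinfun_apply [simp]: "blinfun_apply inr_blinfun y = (0, y)"
  unfolding inr_blinfun_def
  by (subst bounded_linear_Blinfun_apply)
    (auto intro: bounded_linear_Pair bounded_linear_ident bounded_linear_zero)

lemma blinfun_prod_decomp:
  fixes M :: "('a::real_normed_vector \<times> 'b::real_normed_vector) \<Rightarrow>\<^sub>L 'c::real_normed_vector"
  shows "M = ((M o\<^sub>L inl_blinfun) o\<^sub>L fst_blinfun) + ((M o\<^sub>L inr_blinfun) o\<^sub>L snd_blinfun)"
  by (rule blinfun_eqI) (auto simp: blinfun.add_left blinfun.add_right[symmetric])

text \<open>Restriction to a factor is bounded linear in the map, and so is reassembling a map from its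
  restrictions.\<close>

lemma has_vector_derivative_blinfun_prod:
  fixes M :: "real \<Rightarrow> ('a::real_normed_vector \<times> 'b::real_normed_vector) \<Rightarrow>\<^sub>L 'c::real_normed_vector"
  shows "(M has_vector_derivative N) F \<longleftrightarrow>
    ((\<lambda>s. M s o\<^sub>L inl_blinfun) has_vector_derivative (N o\<^sub>L inl_blinfun)) F \<and>
    ((\<lambda>s. M s o\<^sub>L inr_blinfun) has_vector_derivative (N o\<^sub>L inr_blinfun)) F"
    (is "_ \<longleftrightarrow> ?L \<and> ?R")
proof (intro iffI conjI)
  note comp = bounded_linear.has_vector_derivative
    [OF bounded_bilinear.bounded_linear_left[OF bounded_bilinear_blinfun_compose]]
  { assume "(M has_vector_derivative N) F"
    then show ?L and ?R by (auto intro: comp) }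
  assume "?L \<and> ?R"
  then have "((\<lambda>s. ((M s o\<^sub>L inl_blinfun) o\<^sub>L fst_blinfun) + ((M s o\<^sub>L inr_blinfun) o\<^sub>L snd_blinfun))
      has_vector_derivative
      ((N o\<^sub>L inl_blinfun) o\<^sub>L fst_blinfun) + ((N o\<^sub>L inr_blinfun) o\<^sub>L snd_blinfun)) F"
    by (elim conjE) (rule has_vector_derivative_add; rule comp)
  then show "(M has_vector_derivative N) F"
    by (simp add: blinfun_prod_decomp[symmetric])
qed

section \<open>Partial variational derivatives\<close>

lemma var_deriv_eqI:
  assumes "(f has_derivative blinfun_apply D) (at x)"
  shows "var_deriv f x = D"
  by (simp add: var_deriv_def frechet_derivative_at[OF assms, symmetric] blinfun_apply_inverse)

lemma has_derivative_var_deriv: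
  assumes "f differentiable (at x)"
  shows "(f has_derivative blinfun_apply (var_deriv f x)) (at x)"
proof -
  have "(f has_derivative frechet_derivative f (at x)) (at x)"
    using assms by (simp add: frechet_derivative_works)
  then show ?thesis
    unfolding var_deriv_def
    by (simp add: bounded_linear_Blinfun_apply has_derivative_bounded_linear)
qed

lemma has_derivative_slice_fst:
  assumes "f differentiable (at (a, b))"
  shows "((\<lambda>x. f (x, b)) has_derivative blinfun_apply (var_deriv f (a, b) o\<^sub>L inl_blinfun)) (at a)"
proof -
  have "((\<lambda>x. (x, b)) has_derivative (\<lambda>v. (v, 0))) (at a)"
    by (auto intro!: derivative_eq_intros)
  from diff_chain_at[OF this has_derivative_var_deriv[OF assms]]
  show ?thesis by (simp add: o_def blinfun_compose.rep_eq)
qed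

lemma has_derivative_slice_snd:
  assumes "f differentiable (at (a, b))"
  shows "((\<lambda>y. f (a, y)) has_derivative blinfun_apply (var_deriv f (a, b) o\<^sub>L inr_blinfun)) (at b)"
proof -
  have "((\<lambda>y. (a, y)) has_derivative (\<lambda>v. (0, v))) (at b)"
    by (auto intro!: derivative_eq_intros)
  from diff_chain_at[OF this has_derivative_var_deriv[OF assms]]
  show ?thesis by (simp add: o_def blinfun_compose.rep_eq)
qed

lemmas var_deriv_slice_fst = var_deriv_eqI[OF has_derivative_slice_fst]
lemmas var_deriv_slice_snd = var_deriv_eqI[OF has_derivative_slice_snd]

lemma var_deriv_slots:
  assumes l: "l differentiable (at ((a, b), c))"
  shows "var_deriv0 l ((a, b), c) = (var_deriv l ((a, b), c) o\<^sub>L inl_blinfun) o\<^sub>L inl_blinfun"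
    and "var_deriv1 l ((a, b), c) = (var_deriv l ((a, b), c) o\<^sub>L inl_blinfun) o\<^sub>L inr_blinfun"
    and "var_deriv2 l ((a, b), c) = var_deriv l ((a, b), c) o\<^sub>L inr_blinfun"
proof -
  have "(\<lambda>p. l (p, c)) differentiable (at (a, b))"
    using has_derivative_slice_fst[OF l] unfolding differentiable_def by blast
  then show "var_deriv0 l ((a, b), c) = (var_deriv l ((a, b), c) o\<^sub>L inl_blinfun) o\<^sub>L inl_blinfun"
    and "var_deriv1 l ((a, b), c) = (var_deriv l ((a, b), c) o\<^sub>L inl_blinfun) o\<^sub>L inr_blinfun"
    using var_deriv_slice_fst[of "\<lambda>p. l (p, c)" a b] var_deriv_slice_snd[of "\<lambda>p. l (p, c)" a b]
    by (simp_all add: var_deriv0_def var_deriv1_def var_deriv_slice_fst[OF l])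
  show "var_deriv2 l ((a, b), c) = var_deriv l ((a, b), c) o\<^sub>L inr_blinfun"
    by (simp add: var_deriv2_def var_deriv_slice_snd[OF l])
qed

section \<open>The coadjoint action of the second order tangent algebra\<close>

lemma coad_apply:
  assumes "bounded_linear (br \<xi>)"
  shows "blinfun_apply (coad br \<xi> \<mu>) \<zeta> = - blinfun_apply \<mu> (br \<xi> \<zeta>)"
  unfolding coad_def
  by (subst bounded_linear_Blinfun_apply)
    (auto intro: bounded_linear_minus bounded_linear_compose[OF blinfun.bounded_linear_right assms])

context
  fixes br :: "'g::euclidean_space \<Rightarrow> 'g \<Rightarrow> 'g"
  assumes bilinear: "bilinear br" and antisym: "\<And>\<xi> \<zeta>. br \<xi> \<zeta> = - br \<zeta> \<xi>"
begin

lemma bounded_linear_bracket: "bounded_linear (br \<xi>)"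
  using bilinear by (simp add: bilinear_def linear_conv_bounded_linear)

lemma bounded_linear_second_tangent_bracket: "bounded_linear (second_tangent_bracket br \<eta>)"
proof -
  obtain a b c where \<eta>: "\<eta> = ((a, b), c)" by (metis prod.exhaust)
  have "linear (second_tangent_bracket br \<eta>)"
    unfolding \<eta>
    by (rule linearI)
      (auto simp: second_tangent_bracket_eq[OF antisym] bilinear_radd[OF bilinear]
        bilinear_ladd[OF bilinear] bilinear_rmul[OF bilinear] bilinear_lmul[OF bilinear]
        scaleR_add_right scaleR_diff_right)
  then show ?thesis by (simp add: linear_conv_bounded_linear)
qed

lemmas bracket_zero = bilinear_rzero[OF bilinear] bilinear_lzero[OF bilinear]

text \<open>Each restriction is computed by bracketing with a vector that has a single nonzero slot,
  and splitting the resulting triple into its slots.\<close>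

lemma coad_second_tangent_bracket_slot0:
  fixes \<mu> :: "(('g \<times> 'g) \<times> 'g) \<Rightarrow>\<^sub>L real"
  defines "\<mu>\<^sub>0 \<equiv> (\<mu> o\<^sub>L inl_blinfun) o\<^sub>L inl_blinfun" and "\<mu>\<^sub>1 \<equiv> (\<mu> o\<^sub>L inl_blinfun) o\<^sub>L inr_blinfun"
    and "\<mu>\<^sub>2 \<equiv> \<mu> o\<^sub>L inr_blinfun"
  shows "(coad (second_tangent_bracket br) ((a, b), c) \<mu> o\<^sub>L inl_blinfun) o\<^sub>L inl_blinfun =
    coad br a \<mu>\<^sub>0 + coad br b \<mu>\<^sub>1 + coad br c \<mu>\<^sub>2"
proof (rule blinfun_eqI)
  fix z
  have "second_tangent_bracket br ((a, b), c) ((z, 0), 0) =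
      ((br a z, 0), 0) + ((0, br b z), 0) + (0, br c z)"
    by (simp add: second_tangent_bracket_eq[OF antisym] bracket_zero)
  then show "blinfun_apply ((coad (second_tangent_bracket br) ((a, b), c) \<mu> o\<^sub>L inl_blinfun) o\<^sub>L
      inl_blinfun) z = blinfun_apply (coad br a \<mu>\<^sub>0 + coad br b \<mu>\<^sub>1 + coad br c \<mu>\<^sub>2) z"
    by (simp only: \<mu>\<^sub>0_def \<mu>\<^sub>1_def \<mu>\<^sub>2_def blinfun_apply_blinfun_compose inl_blinfun_apply
      inr_blinfun_apply blinfun.add_left blinfun.add_right coad_apply[OF bounded_linear_bracket]
      coad_apply[OF bounded_linear_second_tangent_bracket])
qed

text \<open>The cocycle contributes \<open>- 2 [\<zeta>, \<eta>\<^sub>1]\<close>; antisymmetry turns it into \<open>2 [\<eta>\<^sub>1, \<zeta>]\<close>, which is why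
  the factor 2 appears with the same sign as the other coadjoint terms.\<close>

lemma coad_second_tangent_bracket_slot1:
  fixes \<mu> :: "(('g \<times> 'g) \<times> 'g) \<Rightarrow>\<^sub>L real"
  defines "\<mu>\<^sub>1 \<equiv> (\<mu> o\<^sub>L inl_blinfun) o\<^sub>L inr_blinfun" and "\<mu>\<^sub>2 \<equiv> \<mu> o\<^sub>L inr_blinfun"
  shows "(coad (second_tangent_bracket br) ((a, b), c) \<mu> o\<^sub>L inl_blinfun) o\<^sub>L inr_blinfun =
    coad br a \<mu>\<^sub>1 + 2 *\<^sub>R coad br b \<mu>\<^sub>2"
proof (rule blinfun_eqI)
  fix z
  have "second_tangent_bracket br ((a, b), c) ((0, z), 0) =
      ((0, br a z), 0) + 2 *\<^sub>R (0, br b z)"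
    using antisym[of z b] by (simp add: second_tangent_bracket_eq[OF antisym] bracket_zero)
  then show "blinfun_apply ((coad (second_tangent_bracket br) ((a, b), c) \<mu> o\<^sub>L inl_blinfun) o\<^sub>L
      inr_blinfun) z = blinfun_apply (coad br a \<mu>\<^sub>1 + 2 *\<^sub>R coad br b \<mu>\<^sub>2) z"
    by (simp only: \<mu>\<^sub>1_def \<mu>\<^sub>2_def blinfun_apply_blinfun_compose inl_blinfun_apply inr_blinfun_apply
      blinfun.add_left blinfun.add_right blinfun.scaleR_left blinfun.scaleR_right
      coad_apply[OF bounded_linear_bracket] coad_apply[OF bounded_linear_second_tangent_bracket])
      simp
qed

lemma coad_second_tangent_bracket_slot2:
  fixes \<mu> :: "(('g \<times> 'g) \<times> 'g) \<Rightarrow>\<^sub>L real"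
  shows "coad (second_tangent_bracket br) ((a, b), c) \<mu> o\<^sub>L inr_blinfun =
    coad br a (\<mu> o\<^sub>L inr_blinfun)"
  by (rule blinfun_eqI)
    (simp add: coad_apply[OF bounded_linear_bracket] zero_prod_def
      coad_apply[OF bounded_linear_second_tangent_bracket] second_tangent_bracket_eq[OF antisym]
      bracket_zero)

end

section \<open>The Euler-Poincare equations\<close>

theorem corollary5p3:
  fixes G :: "'a monoid" and X :: "'a topology"
    and \<A> :: "('a set \<times> ('a \<Rightarrow> 'g::euclidean_space)) set"
    and br :: "'g \<Rightarrow> 'g \<Rightarrow> 'g"
    and l :: "('g \<times> 'g) \<times> 'g \<Rightarrow> real"
    and \<eta>\<^sub>0 \<eta>\<^sub>1 \<eta>\<^sub>2 :: "real \<Rightarrow> 'g" and T :: "real set"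
  assumes "lie_group G X \<A>"
    and "(U, \<phi>) \<in> \<A>" and "\<one>\<^bsub>G\<^esub> \<in> U"
    and br: "br = lie_bracket G U \<phi>"
    and l: "\<And>\<eta>. l differentiable (at \<eta>)"
    and T: "is_interval T"
  shows "euler_poincare_on T (second_tangent_bracket br) l (\<lambda>t. ((\<eta>\<^sub>0 t, \<eta>\<^sub>1 t), \<eta>\<^sub>2 t)) \<longleftrightarrow>
    (\<forall>t\<in>T. let \<mu>\<^sub>0 = \<lambda>s. var_deriv0 l ((\<eta>\<^sub>0 s, \<eta>\<^sub>1 s), \<eta>\<^sub>2 s);
               \<mu>\<^sub>1 = \<lambda>s. var_deriv1 l ((\<eta>\<^sub>0 s, \<eta>\<^sub>1 s), \<eta>\<^sub>2 s);
               \<mu>\<^sub>2 = \<lambda>s. var_deriv2 l ((\<eta>\<^sub>0 s, \<eta>\<^sub>1 s), \<eta>\<^sub>2 s)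
           in (\<mu>\<^sub>0 has_vector_derivative
                - coad br (\<eta>\<^sub>0 t) (\<mu>\<^sub>0 t) - coad br (\<eta>\<^sub>1 t) (\<mu>\<^sub>1 t) - coad br (\<eta>\<^sub>2 t) (\<mu>\<^sub>2 t))
                (at t within T)
            \<and> (\<mu>\<^sub>1 has_vector_derivative
                - coad br (\<eta>\<^sub>0 t) (\<mu>\<^sub>1 t) - 2 *\<^sub>R coad br (\<eta>\<^sub>1 t) (\<mu>\<^sub>2 t)) (at t within T)
            \<and> (\<mu>\<^sub>2 has_vector_derivative - coad br (\<eta>\<^sub>0 t) (\<mu>\<^sub>2 t)) (at t within T))"
proof -
  interpret lie_group G X \<A> by fact
  have bilinear: "bilinear br"
    unfolding br using bilinear_lie_bracket assms(2,3) .
  have antisym: "br \<xi> \<zeta> = - br \<zeta> \<xi>" for \<xi> \<zeta>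
    unfolding br by (rule lie_bracket_antisym)
  have compose_minus: "(- A) o\<^sub>L B = - (A o\<^sub>L B)" for A :: "'y::real_normed_vector \<Rightarrow>\<^sub>L real"
    and B :: "'x::real_normed_vector \<Rightarrow>\<^sub>L 'y"
    by (rule bounded_bilinear.minus_left[OF bounded_bilinear_blinfun_compose])
  show ?thesis
    unfolding euler_poincare_on_def Let_def
    by (simp add: has_vector_derivative_blinfun_prod var_deriv_slots[OF l] compose_minus
      coad_second_tangent_bracket_slot0[OF bilinear antisym]
      coad_second_tangent_bracket_slot1[OF bilinear antisym]
      coad_second_tangent_bracket_slot2[OF bilinear antisym] conj_assoc)
qed

end
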